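(* Let $[a,b,c]$ be a primitive Pythagorean triple with $a$ odd, and let $ABC$ be the right triangle with $C=(0,0)$, $B=(a,0)$, $A=(0,b)$. Put $$r_1=\tfrac12(a+b-c),\quad r_2=\tfrac12(a-b+c),\quad r_3=\tfrac12(-a+b+c),\quad r_4=\tfrac12(a+b+c),$$ and let $I_1=(r_1,r_1)$, $I_2=(r_2,-r_2)$, $I_3=(-r_3,r_3)$, $I_4=(r_4,r_4)$ be the centers of the in-circle (radius $r_1$) and of the three ex-circles (radii $r_2,r_3,r_4$) of $ABC$. Let $F=(\tfrac a4,\tfrac b4)$, the center of the nine-point circle $\mathcal{N}$ of $ABC$, which has radius $\tfrac c4$. Then $\mathcal{N}$ is tangent to the in-circle and to the three ex-circles. Moreover, the segments $\overline{I_3F}$, $\overline{I_4F}$, $\overline{I_2F}$ are the hypotenuses of right triangles, with legs parallel to the coordinate axes, that are copies scaled by $\tfrac14$ of the three children of $[a,b,c]$ in the tree of primitive Pythagorean triples (the left, middle and right child, respectively); and, if $[a,b,c]\ne[3,4,5]$, the segment $\overline{I_1F}$ is likewise the hypotenuse of a copy scaled by $\tfrac14$ of the parent of $[a,b,c]$.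
   Context: A primitive Pythagorean triple $[a,b,c]$ consists of positive integers with $a^2+b^2=c^2$ and $\gcd(a,b,c)=1$; by convention $a$ is odd. The nine-point circle of a triangle is the circle through the midpoints of its sides. Tree of primitive triples: a valid sequence is $\mathcal{P}=[q',q,p,p']$ where $q'$ is an odd positive integer, $q$ is a positive integer with $\gcd(q',q)=1$, $p=q'+q$ and $p'=q+p$; valid sequences correspond bijectively to primitive triples via $[a,b,c]=[p'q',\,2pq,\,p^2+q^2]$. The left, middle and right children of the triple with sequence $[q',q,p,p']$ are the triples whose valid sequences have first two entries $(p',q)$, $(p',p)$ and $(q',p)$ respectively (corresponding to promotion of the circle of radius $r_3$, $r_4$, $r_2$ respectively to the in-circle). The parent of a triple $T\neq[3,4,5]$ is the unique primitive triple having $T$ as a child. *)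

theory Defs
  imports "HOL-Analysis.Analysis"
begin

section \<open>Primitive Pythagorean triples and their tree\<close>

type_synonym triple = "nat \<times> nat \<times> nat"

definition primitive_triple :: "triple \<Rightarrow> bool" where
  "primitive_triple = (\<lambda>(a, b, c).
     0 < a \<and> 0 < b \<and> 0 < c \<and> a\<^sup>2 + b\<^sup>2 = c\<^sup>2 \<and> gcd (gcd a b) c = 1 \<and> odd a)"

text \<open>A sequence \<open>[q', q, p, p']\<close> is represented as a 4-tuple.\<close>

type_synonym sequence = "nat \<times> nat \<times> nat \<times> nat"

definition valid_sequence :: "sequence \<Rightarrow> bool" where
  "valid_sequence = (\<lambda>(q', q, p, p').
     0 < q' \<and> odd q' \<and> 0 < q \<and> coprime q' q \<and> p = q' + q \<and> p' = q + p)"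

definition triple_of :: "sequence \<Rightarrow> triple" where
  "triple_of = (\<lambda>(q', q, p, p'). (p' * q', 2 * p * q, p\<^sup>2 + q\<^sup>2))"

definition sequence_of :: "triple \<Rightarrow> sequence" where
  "sequence_of T = (THE P. valid_sequence P \<and> triple_of P = T)"

definition sequence_from :: "nat \<Rightarrow> nat \<Rightarrow> sequence" where
  "sequence_from q' q = (q', q, q' + q, q + (q' + q))"

definition left_child :: "triple \<Rightarrow> triple" where
  "left_child T = (case sequence_of T of (q', q, p, p') \<Rightarrow> triple_of (sequence_from p' q))"

definition middle_child :: "triple \<Rightarrow> triple" where
  "middle_child T = (case sequence_of T of (q', q, p, p') \<Rightarrow> triple_of (sequence_from p' p))"

definition right_child :: "triple \<Rightarrow> triple" where
  "right_child T = (case sequence_of T of (q', q, p, p') \<Rightarrow> triple_of (sequence_from q' p))"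

definition parent :: "triple \<Rightarrow> triple" where
  "parent T = (THE T'. primitive_triple T' \<and>
     T \<in> {left_child T', middle_child T', right_child T'})"

section \<open>Plane geometry\<close>

text \<open>The metric of the product type is the Euclidean one.\<close>

type_synonym point = "real \<times> real"

definition is_circle :: "point set \<Rightarrow> bool" where
  "is_circle S \<longleftrightarrow> (\<exists>M r. 0 < r \<and> S = sphere M r)"

definition tangent_circles :: "point set \<Rightarrow> point set \<Rightarrow> bool" where
  "tangent_circles S S' \<longleftrightarrow> is_circle S \<and> is_circle S' \<and> (\<exists>P. S \<inter> S' = {P})"

definition tangent_to_line_at :: "point set \<Rightarrow> point \<Rightarrow> point \<Rightarrow> point \<Rightarrow> bool" where
  "tangent_to_line_at S X Y P \<longleftrightarrow> S \<inter> affine hull {X, Y} = {P}"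

definition touches_side :: "point set \<Rightarrow> point \<Rightarrow> point \<Rightarrow> bool" where
  "touches_side S X Y \<longleftrightarrow> (\<exists>P \<in> open_segment X Y. tangent_to_line_at S X Y P)"

definition touches_extension :: "point set \<Rightarrow> point \<Rightarrow> point \<Rightarrow> bool" where
  "touches_extension S X Y \<longleftrightarrow> (\<exists>P. P \<notin> closed_segment X Y \<and> tangent_to_line_at S X Y P)"

definition is_incircle :: "point \<Rightarrow> point \<Rightarrow> point \<Rightarrow> point set \<Rightarrow> bool" where
  "is_incircle A B C S \<longleftrightarrow>
     is_circle S \<and> touches_side S A B \<and> touches_side S B C \<and> touches_side S C A"

text \<open>The ex-circle of the triangle \<open>ABC\<close> opposite its first vertex \<open>A\<close>.\<close>

definition is_excircle_opposite :: "point \<Rightarrow> point \<Rightarrow> point \<Rightarrow> point set \<Rightarrow> bool" where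
  "is_excircle_opposite A B C S \<longleftrightarrow>
     is_circle S \<and> touches_side S B C \<and> touches_extension S A B \<and> touches_extension S A C"

definition is_nine_point_circle :: "point \<Rightarrow> point \<Rightarrow> point \<Rightarrow> point set \<Rightarrow> bool" where
  "is_nine_point_circle A B C S \<longleftrightarrow>
     is_circle S \<and> midpoint A B \<in> S \<and> midpoint B C \<in> S \<and> midpoint C A \<in> S"

text \<open>\<open>S'\<close> is the image of \<open>S\<close> under a similarity of the plane of ratio \<open>k\<close>
  (reflections allowed).\<close>

definition scaled_copy :: "real \<Rightarrow> point set \<Rightarrow> point set \<Rightarrow> bool" where
  "scaled_copy k S S' \<longleftrightarrow>
     (\<exists>f :: point \<Rightarrow> point. (\<forall>x y. dist (f x) (f y) = k * dist x y) \<and> S' = f ` S)"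

definition triangle_of :: "triple \<Rightarrow> point set" where
  "triangle_of = (\<lambda>(a, b, c). convex hull {(0, 0), (real a, 0), (0, real b)})"

definition axis_parallel :: "point \<Rightarrow> point \<Rightarrow> bool" where
  "axis_parallel X Y \<longleftrightarrow> fst X = fst Y \<or> snd X = snd Y"

text \<open>The segment \<open>XY\<close> is the hypotenuse of a right triangle \<open>XYZ\<close> with axis-parallel legs
  that is a copy, scaled by \<open>k\<close>, of the right triangle given by the triple \<open>T\<close>.\<close>

definition hypotenuse_of_scaled_copy :: "real \<Rightarrow> triple \<Rightarrow> point \<Rightarrow> point \<Rightarrow> bool" where
  "hypotenuse_of_scaled_copy k T X Y \<longleftrightarrow>
     (\<exists>Z. Z \<noteq> X \<and> Z \<noteq> Y \<and> orthogonal (X - Z) (Y - Z) \<and>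
          axis_parallel Z X \<and> axis_parallel Z Y \<and>
          scaled_copy k (triangle_of T) (convex hull {X, Y, Z}))"

end

(* In terms of the valid sequence [q', q, p, p'] the four radii are q'q, q'p, qp', pp'. The
   horizontal and vertical distances between F and each of the four centers are then, up to the
   factor 1/4, explicit products that are the legs of the children and the parent; their
   hypotenuses are |c - 4 r1| and c + 4 r_i for i = 2, 3, 4, so the distances from F are
   c/4 - r1 and c/4 + r_i, which gives the tangency. *)
theory Submission
  imports Defs "HOL-Computational_Algebra.Nth_Powers"
begin

section \<open>The tree of triples\<close>

lemma valid_sequence_from [simp]:
  "valid_sequence (sequence_from s q) \<longleftrightarrow> 0 < s \<and> odd s \<and> 0 < q \<and> coprime s q"
  by (auto simp: valid_sequence_def sequence_from_def)

lemma valid_sequenceE: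
  assumes "valid_sequence P"
  obtains s q where "P = sequence_from s q"
  using assms by (auto simp: valid_sequence_def sequence_from_def split: prod.splits)

lemma triple_of_sequence_from:
  "triple_of (sequence_from s q) = (s * (s + 2 * q), 2 * q * (s + q), (s + q)\<^sup>2 + q\<^sup>2)"
  by (simp add: triple_of_def sequence_from_def algebra_simps)

text \<open>The entries of the sequence are recovered from \<open>c - b = q'\<^sup>2\<close> and \<open>c + b = p'\<^sup>2\<close>.\<close>

lemma triple_of_sequence_from_inject:
  assumes "triple_of (sequence_from s q) = triple_of (sequence_from s' q')"
  shows "s = s' \<and> q = q'"
proof -
  have diff: "(x + y)\<^sup>2 + y\<^sup>2 = 2 * y * (x + y) + x\<^sup>2" for x y :: nat
    by (simp add: power2_eq_square algebra_simps)
  have sum: "((x + y)\<^sup>2 + y\<^sup>2) + 2 * y * (x + y) = (x + 2 * y)\<^sup>2" for x y :: nat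
    by (simp add: power2_eq_square algebra_simps)
  have b: "2 * q * (s + q) = 2 * q' * (s' + q')" and c: "(s + q)\<^sup>2 + q\<^sup>2 = (s' + q')\<^sup>2 + q'\<^sup>2"
    using assms by (auto simp: triple_of_sequence_from)
  have "s\<^sup>2 = s'\<^sup>2"
    using diff[of s q] diff[of s' q'] b c by linarith
  moreover have "(s + 2 * q)\<^sup>2 = (s' + 2 * q')\<^sup>2"
    using sum[of s q] sum[of s' q'] b c by presburger
  ultimately show ?thesis
    by (simp add: power2_eq_iff_nonneg)
qed

lemma coprime_add_double_iff: "coprime (s + 2 * q) q \<longleftrightarrow> coprime s q" for s q :: nat
  using gcd_add_mult[of q 2 s] by (metis add.commute coprime_iff_gcd_eq_1 gcd.commute)

text \<open>The legs are \<open>q' * p'\<close> and \<open>2 * p * q\<close>; their coprimality is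
  checked factor by factor: \<open>q'\<close> and \<open>p'\<close> are odd, and each is coprime to
  both \<open>q\<close> and \<open>p\<close>.\<close>

lemma primitive_triple_of_sequence_from:
  assumes "valid_sequence (sequence_from s q)"
  shows "primitive_triple (triple_of (sequence_from s q))"
proof -
  have v: "0 < s" "odd s" "0 < q" "coprime s q"
    using assms by simp_all
  have cop: "coprime (s * (s + 2 * q)) (2 * q * (s + q))"
  proof -
    have "coprime s 2" "coprime (s + 2 * q) 2"
      using v by simp_all
    moreover have "coprime s (s + q)"
      using v by (simp add: coprime_iff_gcd_eq_1)
    moreover have "coprime (s + 2 * q) q"
      using v by (simp add: coprime_add_double_iff)
    moreover have "coprime (s + 2 * q) (s + q)"
    proof -
      \<comment> \<open>This is \<open>p' = q + p\<close>: one Euclidean step replaces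
        \<open>p'\<close> by \<open>q\<close>, a second one replaces \<open>p\<close> by
        \<open>s\<close>.\<close>
      have "s + 2 * q = q + (s + q)"
        by simp
      then have "gcd (s + 2 * q) (s + q) = gcd q (s + q)"
        by (simp only: gcd_add1)
      then show ?thesis
        using v by (metis add.commute coprime_iff_gcd_eq_1 gcd.commute gcd_add2)
    qed
    ultimately show ?thesis
      using v by simp
  qed
  have "(s * (s + 2 * q))\<^sup>2 + (2 * q * (s + q))\<^sup>2 = ((s + q)\<^sup>2 + q\<^sup>2)\<^sup>2"
    by (simp add: power2_eq_square algebra_simps)
  then show ?thesis
    using v cop by (simp add: primitive_triple_def triple_of_sequence_from)
qed

text \<open>In \<open>a\<^sup>2 = (c - b) * (c + b)\<close> the two factors are odd and coprime, so
  both are squares; their roots are the entries \<open>q'\<close> and \<open>p'\<close>, and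
  \<open>q\<close> is half the difference of the roots.\<close>

lemma primitive_tripleE:
  assumes "primitive_triple T"
  obtains s q where "valid_sequence (sequence_from s q)" "T = triple_of (sequence_from s q)"
proof -
  obtain a b c where T: "T = (a, b, c)"
    by (metis prod_cases3)
  have pos: "0 < a" "0 < b" "0 < c" and pyth: "a\<^sup>2 + b\<^sup>2 = c\<^sup>2"
    and gcd1: "gcd (gcd a b) c = 1" and "odd a"
    using assms by (auto simp: primitive_triple_def T)
  have "b\<^sup>2 < c\<^sup>2"
    using pyth pos by (metis less_add_same_cancel2 zero_less_power)
  then have bc: "b < c"
    by (simp add: power_less_imp_less_base)
  have prod: "(c - b) * (c + b) = a\<^sup>2"
  proof -
    have "c = b + (c - b)"
      using bc by simp
    then obtain d where "c = b + d"
      by blast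
    then show ?thesis
      using pyth by (simp add: power2_eq_square algebra_simps)
  qed
  have odd: "odd (c - b)" "odd (c + b)"
    using prod \<open>odd a\<close> by (metis even_mult_iff even_power)+
  have cop: "coprime (c - b) (c + b)"
  proof (rule ccontr)
    assume "\<not> ?thesis"
    then obtain x where x: "prime x" "x dvd c - b" "x dvd c + b"
      by (metis coprime_iff_gcd_eq_1 gcd_greatest_iff prime_factor_nat)
    \<comment> \<open>The two factors add up to \<open>2 * c\<close>. As a divisor of the odd number
      \<open>c - b\<close>, \<open>x\<close> is not 2, so it divides \<open>c\<close>, then
      \<open>b\<close>, and through the product also \<open>a\<close>.\<close>
    have "x dvd 2 * c"
      using x bc dvd_add[of x "c - b" "c + b"] by (simp add: mult_2)
    moreover have "\<not> x dvd 2"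
      using x odd by (metis primes_dvd_imp_eq two_is_prime_nat)
    ultimately have xc: "x dvd c"
      using x by (simp add: prime_dvd_mult_iff)
    then have xb: "x dvd b"
      using x by (simp add: dvd_add_right_iff)
    have "x dvd a\<^sup>2"
      using prod x by (metis dvd_mult2)
    then have "x dvd a"
      using x prime_dvd_power by blast
    then have "x dvd gcd (gcd a b) c"
      using xb xc by simp
    then show False
      using gcd1 x by auto
  qed
  have "is_square ((c - b) * (c + b))"
    using prod by auto
  then obtain s t where s: "c - b = s\<^sup>2" and t: "c + b = t\<^sup>2"
    using is_nth_power_mult_coprime_nat_iff[OF cop, of 2] by (auto elim!: is_nth_powerE)
  have "s\<^sup>2 < t\<^sup>2"
    using s t pos bc by linarith
  then have st: "s < t"
    by (simp add: power_less_imp_less_base)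
  have ost: "odd s" "odd t"
    using odd s t by auto
  \<comment> \<open>\<open>t\<close> is to be \<open>p' = q' + 2 * q\<close>; the division is exact
    because \<open>s\<close> and \<open>t\<close> are both odd.\<close>
  define q where "q = (t - s) div 2"
  have tq: "t = s + 2 * q"
    using st ost by (simp add: q_def)
  have "a\<^sup>2 = (s * t)\<^sup>2"
    using prod s t by (simp add: power_mult_distrib)
  then have a: "a = s * (s + 2 * q)"
    using tq by simp
  have "2 * b = t\<^sup>2 - s\<^sup>2"
    using s t bc by linarith
  then have b: "b = 2 * q * (s + q)"
    unfolding tq by (simp add: power2_eq_square algebra_simps)
  have c: "c = (s + q)\<^sup>2 + q\<^sup>2"
    using s bc b by (simp add: power2_eq_square algebra_simps)
  have "coprime s t"
    using cop s t by simp
  then have "coprime s q"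
    unfolding tq by (metis coprime_iff_gcd_eq_1 coprime_mult_right_iff gcd_add2)
  then have "valid_sequence (sequence_from s q)"
    using ost st tq by (auto intro: odd_pos)
  then show ?thesis
    using that a b c T by (simp add: triple_of_sequence_from)
qed

section \<open>Children and parents in terms of sequences\<close>

lemma sequence_of_triple_of:
  assumes "valid_sequence (sequence_from s q)"
  shows "sequence_of (triple_of (sequence_from s q)) = sequence_from s q"
  unfolding sequence_of_def
proof (rule the_equality)
  fix P
  assume "valid_sequence P \<and> triple_of P = triple_of (sequence_from s q)"
  then show "P = sequence_from s q"
    by (metis valid_sequenceE triple_of_sequence_from_inject)
qed (use assms in simp)

lemma
  assumes "valid_sequence (sequence_from s q)"
  shows left_child_triple_of:
      "left_child (triple_of (sequence_from s q)) = triple_of (sequence_from (s + 2 * q) q)"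
    and middle_child_triple_of:
      "middle_child (triple_of (sequence_from s q)) = triple_of (sequence_from (s + 2 * q) (s + q))"
    and right_child_triple_of:
      "right_child (triple_of (sequence_from s q)) = triple_of (sequence_from s (s + q))"
proof -
  have "sequence_from s q = (s, q, s + q, s + 2 * q)"
    by (simp add: sequence_from_def)
  then show
      "left_child (triple_of (sequence_from s q)) = triple_of (sequence_from (s + 2 * q) q)"
      "middle_child (triple_of (sequence_from s q)) = triple_of (sequence_from (s + 2 * q) (s + q))"
      "right_child (triple_of (sequence_from s q)) = triple_of (sequence_from s (s + q))"
    using sequence_of_triple_of[OF assms]
    by (simp_all add: left_child_def middle_child_def right_child_def)
qed

text \<open>Injectivity of \<open>triple_of\<close> turns membership among the children into linear
  equations between entries, so that uniqueness of the parent becomes arithmetic.\<close>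

lemma child_iff:
  assumes "valid_sequence (sequence_from s q)"
  shows "triple_of (sequence_from S Q) \<in> {left_child (triple_of (sequence_from s q)),
      middle_child (triple_of (sequence_from s q)), right_child (triple_of (sequence_from s q))} \<longleftrightarrow>
    (S = s + 2 * q \<and> Q = q) \<or> (S = s + 2 * q \<and> Q = s + q) \<or> (S = s \<and> Q = s + q)"
  using triple_of_sequence_from_inject
  by (auto simp: left_child_triple_of[OF assms] middle_child_triple_of[OF assms]
      right_child_triple_of[OF assms])

text \<open>Being a left, middle or right child amounts to \<open>S > 2Q\<close>, \<open>Q < S < 2Q\<close> or \<open>S < Q\<close>
  respectively, so each of these cases determines the parent.\<close>

lemma parent_triple_of:
  assumes vc: "valid_sequence (sequence_from S Q)" and v: "valid_sequence (sequence_from s q)"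
    and child: "(S = s + 2 * q \<and> Q = q) \<or> (S = s + 2 * q \<and> Q = s + q) \<or> (S = s \<and> Q = s + q)"
  shows "parent (triple_of (sequence_from S Q)) = triple_of (sequence_from s q)"
  unfolding parent_def
proof (rule the_equality)
  show "primitive_triple (triple_of (sequence_from s q)) \<and>
      triple_of (sequence_from S Q) \<in> {left_child (triple_of (sequence_from s q)),
        middle_child (triple_of (sequence_from s q)), right_child (triple_of (sequence_from s q))}"
    using primitive_triple_of_sequence_from[OF v] child_iff[OF v] child by blast
next
  fix T'
  assume T': "primitive_triple T' \<and>
    triple_of (sequence_from S Q) \<in> {left_child T', middle_child T', right_child T'}"
  then obtain s' q' where v': "valid_sequence (sequence_from s' q')"
    and eq: "T' = triple_of (sequence_from s' q')"
    by (blast elim: primitive_tripleE)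
  have "(S = s' + 2 * q' \<and> Q = q') \<or> (S = s' + 2 * q' \<and> Q = s' + q') \<or> (S = s' \<and> Q = s' + q')"
    using T' child_iff[OF v', of S Q] by (simp add: eq)
  then have "s' = s \<and> q' = q"
    using child v v' by auto
  then show "T' = triple_of (sequence_from s q)"
    by (simp add: eq)
qed

text \<open>Comparing \<open>S\<close> with \<open>Q\<close> and \<open>2 * Q\<close> decides which
  kind of child is at hand, and the equations of that case are solved for the parent's entries. By
  coprimality \<open>S = Q\<close> occurs only at the root \<open>(1, 1)\<close>, the triple
  \<open>[3, 4, 5]\<close>; \<open>S = 2 * Q\<close> contradicts the oddness of
  \<open>S\<close>.\<close>

lemma parent_sequence_exists:
  assumes "valid_sequence (sequence_from S Q)" "(S, Q) \<noteq> (1, 1)"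
  obtains s q where "valid_sequence (sequence_from s q)"
    "(S = s + 2 * q \<and> Q = q) \<or> (S = s + 2 * q \<and> Q = s + q) \<or> (S = s \<and> Q = s + q)"
proof -
  have v: "0 < S" "odd S" "0 < Q" "coprime S Q"
    using assms by simp_all
  have "S \<noteq> Q"
    using v assms(2) by auto
  moreover have "S \<noteq> 2 * Q"
    using v by auto
  ultimately consider "S > 2 * Q" | "Q < S" "S < 2 * Q" | "S < Q"
    by linarith
  then show ?thesis
  proof cases
    case 1
    define s where "s = S - 2 * Q"
    then have s: "S = s + 2 * Q" "0 < s"
      using 1 by simp_all
    have "coprime s Q"
      using v s coprime_add_double_iff by simp
    then show ?thesis
      using that[of s Q] v s by simp
  next
    case 2
    \<comment> \<open>Subtracting \<open>Q = s + q\<close> from \<open>S = s + 2 * q\<close> leaves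
      \<open>q\<close>, and then \<open>s\<close> follows.\<close>
    define q s where "q = S - Q" and "s = Q - q"
    then have q: "S = q + Q" "0 < q" and s: "Q = s + q" "0 < s"
      using 2 by simp_all
    have "coprime s q"
      using v q s by (metis coprime_iff_gcd_eq_1 gcd.commute gcd_add1)
    moreover have S: "S = s + 2 * q"
      using q s by simp
    moreover have "odd s"
      using v S by simp
    ultimately show ?thesis
      using that[of s q] q s by simp
  next
    case 3
    define q where "q = Q - S"
    then have q: "Q = S + q" "0 < q"
      using 3 by simp_all
    have "coprime S q"
      using v q by (simp add: coprime_iff_gcd_eq_1)
    then show ?thesis
      using that[of S q] v q by simp
  qed
qed

section \<open>Tangency\<close>

lemma tangent_to_line_atI:
  assumes "r = dist M P" "P \<in> affine hull {X, Y}" "orthogonal (M - P) (Y - X)"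
  shows "tangent_to_line_at (sphere M r) X Y P"
proof -
  have "Z = P" if Z: "Z \<in> affine hull {X, Y}" "dist M Z = r" for Z
  proof -
    obtain u where u: "P = X + u *\<^sub>R (Y - X)"
      using assms(2) by (auto simp: affine_hull_2_alt)
    obtain v where v: "Z = X + v *\<^sub>R (Y - X)"
      using Z by (auto simp: affine_hull_2_alt)
    have PZ: "P - Z = (u - v) *\<^sub>R (Y - X)"
      by (simp add: u v algebra_simps)
    have "orthogonal (M - P) (P - Z)"
      unfolding PZ using assms(3) by (simp add: orthogonal_def)
    \<comment> \<open>The orthogonal vectors \<open>M - P\<close> and \<open>P - Z\<close> add up to
      \<open>M - Z\<close>, and both \<open>M - P\<close> and \<open>M - Z\<close> have length
      \<open>r\<close>.\<close>
    from norm_add_Pythagorean[OF this] have "(norm (P - Z))\<^sup>2 = 0"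
      using Z assms(1) by (simp add: dist_norm)
    then show "Z = P"
      by simp
  qed
  then show ?thesis
    using assms by (auto simp: tangent_to_line_at_def)
qed

text \<open>The number \<open>e\<close> is the signed tangent length from \<open>X\<close>, in the direction of \<open>Y\<close>.\<close>

lemma tangent_to_line_at_foot:
  assumes "0 < r" "0 < d" "dist X Y = d"
    and "inner (M - X) (Y - X) = e * d" "(dist M X)\<^sup>2 = r\<^sup>2 + e\<^sup>2"
  shows "tangent_to_line_at (sphere M r) X Y (X + (e / d) *\<^sub>R (Y - X))"
proof (rule tangent_to_line_atI)
  let ?P = "X + (e / d) *\<^sub>R (Y - X)"
  have d2: "inner (Y - X) (Y - X) = d\<^sup>2"
    using assms(3) by (simp add: dist_norm norm_minus_commute power2_norm_eq_inner[symmetric])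
  have split: "M - ?P = (M - X) - (e / d) *\<^sub>R (Y - X)"
    by simp
  have "inner (M - ?P) (Y - X) = inner (M - X) (Y - X) - e / d * inner (Y - X) (Y - X)"
    by (simp only: split inner_diff_left[of "M - X"] inner_scaleR_left)
  also have "\<dots> = 0"
    unfolding assms(4) d2 using assms(2) by (simp add: power2_eq_square)
  finally show orth: "orthogonal (M - ?P) (Y - X)"
    by (simp only: orthogonal_def)
  then have "orthogonal (M - ?P) ((e / d) *\<^sub>R (Y - X))"
    by (simp add: orthogonal_def)
  \<comment> \<open>The triangle \<open>X\<close>, \<open>?P\<close>, \<open>M\<close> has its right
    angle at the foot \<open>?P\<close>; removing the leg of length \<open>\<bar>e\<bar>\<close>
    from the square of the hypotenuse leaves \<open>r\<^sup>2\<close>.\<close>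
  from norm_add_Pythagorean[OF this]
  have "(dist M X)\<^sup>2 = (dist M ?P)\<^sup>2 + (norm ((e / d) *\<^sub>R (Y - X)))\<^sup>2"
    by (simp add: dist_norm)
  also have "(norm ((e / d) *\<^sub>R (Y - X)))\<^sup>2 = (e / d)\<^sup>2 * d\<^sup>2"
    using assms(3) by (simp add: dist_norm norm_minus_commute power_mult_distrib power_divide)
  also have "\<dots> = e\<^sup>2"
    using assms(2) by (simp add: power_divide)
  finally have "(dist M ?P)\<^sup>2 = r\<^sup>2"
    using assms(5) by simp
  then show "r = dist M ?P"
    using assms(1) by simp
  show "?P \<in> affine hull {X, Y}"
    by (auto simp: affine_hull_2_alt)
qed

text \<open>The foot has parameter \<open>e / d\<close> along the segment, strictly between 0 and
  1.\<close>

lemma touches_sideI: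
  assumes "0 < r" "dist X Y = d" "0 < e" "e < d"
    and "inner (M - X) (Y - X) = e * d" "(dist M X)\<^sup>2 = r\<^sup>2 + e\<^sup>2"
  shows "touches_side (sphere M r) X Y"
  unfolding touches_side_def
proof
  let ?P = "X + (e / d) *\<^sub>R (Y - X)"
  have "X \<noteq> Y" "0 < e / d" "e / d < 1"
    using assms by auto
  then show "?P \<in> open_segment X Y"
    by (auto simp: in_segment algebra_simps intro!: exI[of _ "e / d"])
  show "tangent_to_line_at (sphere M r) X Y ?P"
    using assms by (intro tangent_to_line_at_foot) auto
qed

text \<open>Here the parameter \<open>e / d\<close> of the foot is negative or exceeds 1. Parameters
  on the line are unique because \<open>X \<noteq> Y\<close>, so the foot is off the
  segment.\<close>

lemma touches_extensionI:
  assumes "0 < r" "0 < d" "dist X Y = d" "e < 0 \<or> d < e"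
    and "inner (M - X) (Y - X) = e * d" "(dist M X)\<^sup>2 = r\<^sup>2 + e\<^sup>2"
  shows "touches_extension (sphere M r) X Y"
  unfolding touches_extension_def
proof (intro exI conjI)
  let ?P = "X + (e / d) *\<^sub>R (Y - X)"
  have ne: "X \<noteq> Y" and e: "e / d < 0 \<or> 1 < e / d"
    using assms by (auto simp: divide_less_0_iff)
  show "?P \<notin> closed_segment X Y"
  proof
    assume "?P \<in> closed_segment X Y"
    then obtain u where u: "0 \<le> u" "u \<le> 1" "?P = X + u *\<^sub>R (Y - X)"
      by (auto simp: in_segment algebra_simps)
    then have "e / d = u"
      using ne by (metis add_left_cancel scaleR_cancel_right right_minus_eq)
    with u e show False
      by auto
  qed
  show "tangent_to_line_at (sphere M r) X Y ?P"
    using assms by (intro tangent_to_line_at_foot) auto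
qed

section \<open>Tangency of two circles\<close>

lemma is_circle_sphere: "0 < r \<Longrightarrow> is_circle (sphere M r)"
  unfolding is_circle_def by blast

text \<open>The contact point divides the segment of centers in the ratio \<open>r : r'\<close>. A
  common point gives equality in the triangle inequality, hence lies on that segment, where its
  distances determine it.\<close>

lemma tangent_circles_external:
  fixes M M' :: point
  assumes "0 < r" "0 < r'" "dist M M' = r + r'"
  shows "tangent_circles (sphere M r) (sphere M' r')"
proof -
  define P where "P = M + (r / (r + r')) *\<^sub>R (M' - M)"
  have n: "norm (M' - M) = r + r'"
    using assms by (simp add: dist_norm norm_minus_commute)
  have MP: "dist M P = r"
    using assms n by (simp add: P_def dist_norm)
  have "M' - P = (1 - r / (r + r')) *\<^sub>R (M' - M)"
    by (simp add: P_def algebra_simps)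
  also have "1 - r / (r + r') = r' / (r + r')"
    using assms by (simp add: field_simps)
  finally have M'P: "dist M' P = r'"
    using assms n by (simp add: dist_norm)
  have "Z = P" if "dist M Z = r" "dist M' Z = r'" for Z
  proof -
    have "dist M M' = dist M Z + dist Z M'"
      using that assms by (simp add: dist_commute)
    then have "norm (M - Z) *\<^sub>R (Z - M') = norm (Z - M') *\<^sub>R (M - Z)"
      by (simp add: dist_triangle_eq)
    then have "r *\<^sub>R (Z - M') = r' *\<^sub>R (M - Z)"
      using that by (simp add: dist_norm norm_minus_commute)
    then have "(r + r') *\<^sub>R (Z - M) = r *\<^sub>R (M' - M)"
      by (simp add: algebra_simps)
    then have "(r + r') *\<^sub>R (Z - M) = (r + r') *\<^sub>R (P - M)"
      using assms by (simp add: P_def)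
    then show "Z = P"
      using assms by simp
  qed
  then have "sphere M r \<inter> sphere M' r' = {P}"
    using MP M'P unfolding sphere_def by blast
  then show ?thesis
    using assms by (simp add: tangent_circles_def is_circle_sphere)
qed

text \<open>The contact point lies on the ray from \<open>M\<close> through \<open>M'\<close>,
  beyond \<open>M'\<close>; \<open>r' < r\<close> makes the centers distinct. For a common point
  \<open>Z\<close>, equality in the triangle inequality now places \<open>M'\<close> between
  \<open>M\<close> and \<open>Z\<close>.\<close>

lemma tangent_circles_internal:
  fixes M M' :: point
  assumes "0 < r'" "r' < r" "dist M M' = r - r'"
  shows "tangent_circles (sphere M r) (sphere M' r')"
proof -
  define P where "P = M + (r / (r - r')) *\<^sub>R (M' - M)"
  have n: "norm (M' - M) = r - r'"
    using assms by (simp add: dist_norm norm_minus_commute)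
  have MP: "dist M P = r"
    using assms n by (simp add: P_def dist_norm)
  have "P - M' = (r / (r - r') - 1) *\<^sub>R (M' - M)"
    by (simp add: P_def algebra_simps)
  also have "r / (r - r') - 1 = r' / (r - r')"
    using assms by (simp add: field_simps)
  finally have M'P: "dist M' P = r'"
    using assms n by (simp add: dist_norm norm_minus_commute[of M' P])
  have "Z = P" if "dist M Z = r" "dist M' Z = r'" for Z
  proof -
    have "dist M Z = dist M M' + dist M' Z"
      using that assms by simp
    then have "norm (M - M') *\<^sub>R (M' - Z) = norm (M' - Z) *\<^sub>R (M - M')"
      by (simp add: dist_triangle_eq)
    then have "(r - r') *\<^sub>R (M' - Z) = r' *\<^sub>R (M - M')"
      using that assms(3) by (simp add: dist_norm)
    then have "(r - r') *\<^sub>R (Z - M) = r *\<^sub>R (M' - M)"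
      by (simp add: algebra_simps)
    then have "(r - r') *\<^sub>R (Z - M) = (r - r') *\<^sub>R (P - M)"
      using assms by (simp add: P_def)
    then show "Z = P"
      using assms by simp
  qed
  then have "sphere M r \<inter> sphere M' r' = {P}"
    using MP M'P unfolding sphere_def by blast
  then show ?thesis
    using assms by (simp add: tangent_circles_def is_circle_sphere)
qed

section \<open>Scaled copies\<close>

text \<open>The right angle is put at the corner \<open>(fst Y, snd X)\<close>. Scaling by
  \<open>k\<close>, reflecting in the axes where needed and translating carries the origin to this
  corner, \<open>(a, 0)\<close> to \<open>X\<close> and \<open>(0, b)\<close> to
  \<open>Y\<close>.\<close>

lemma hypotenuse_of_scaled_copyI:
  assumes k: "0 < k" and ab: "0 < a" "0 < b"
    and x: "\<bar>fst X - fst Y\<bar> = k * real a" and y: "\<bar>snd X - snd Y\<bar> = k * real b"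
  shows "hypotenuse_of_scaled_copy k (a, b, c) X Y"
proof -
  define Z where "Z = (fst Y, snd X)"
  \<comment> \<open>The signs record the directions from \<open>Z\<close> to \<open>X\<close> and
    from \<open>Z\<close> to \<open>Y\<close>.\<close>
  define \<sigma> \<tau> where "\<sigma> = sgn (fst X - fst Y)" and "\<tau> = sgn (snd Y - snd X)"
  define g where "g = (\<lambda>z::point. (k * \<sigma> * fst z, k * \<tau> * snd z))"
  define f where "f = (\<lambda>z. Z + g z)"
  have ne: "fst X \<noteq> fst Y" "snd X \<noteq> snd Y"
    using x y k ab by auto
  have st: "\<sigma>\<^sup>2 = 1" "\<tau>\<^sup>2 = 1"
    using ne by (auto simp: \<sigma>_def \<tau>_def sgn_if)
  have lin: "linear g"
    by (rule linearI) (auto simp: g_def algebra_simps)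
  have isom: "dist (f u) (f v) = k * dist u v" for u v
  proof -
    have "(k * \<sigma> * d)\<^sup>2 + (k * \<tau> * e)\<^sup>2 = k\<^sup>2 * (d\<^sup>2 + e\<^sup>2)" for d e
      using st by (simp add: power_mult_distrib algebra_simps)
    moreover have "f u - f v = (k * \<sigma> * (fst u - fst v), k * \<tau> * (snd u - snd v))"
      by (simp add: f_def g_def algebra_simps prod_eq_iff)
    ultimately have "dist (f u) (f v) = sqrt (k\<^sup>2 * ((fst u - fst v)\<^sup>2 + (snd u - snd v)\<^sup>2))"
      by (simp add: dist_norm norm_prod_def)
    then show ?thesis
      using k by (simp add: real_sqrt_mult dist_prod_def dist_real_def)
  qed
  have "f (0, 0) = Z"
    by (simp add: f_def g_def prod_eq_iff)
  moreover have "f (real a, 0) = X"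
    using x ne by (auto simp: f_def g_def Z_def \<sigma>_def prod_eq_iff sgn_if)
  moreover have "f (0, real b) = Y"
    using y ne by (auto simp: f_def g_def Z_def \<tau>_def prod_eq_iff sgn_if)
  ultimately have "{X, Y, Z} = f ` {(0, 0), (real a, 0), (0, real b)}"
    by auto
  \<comment> \<open>The map is split into a linear part and a translation because the convex hull
    commutes with each of them.\<close>
  also have "\<dots> = (\<lambda>z. Z + z) ` g ` {(0, 0), (real a, 0), (0, real b)}"
    unfolding f_def image_image ..
  finally have "convex hull {X, Y, Z} = (\<lambda>z. Z + z) ` g ` triangle_of (a, b, c)"
    by (simp only: convex_hull_translation triangle_of_def prod.case
        convex_hull_linear_image[OF lin])
  also have "\<dots> = f ` triangle_of (a, b, c)"
    unfolding f_def image_image ..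
  finally have "convex hull {X, Y, Z} = f ` triangle_of (a, b, c)" .
  then have "scaled_copy k (triangle_of (a, b, c)) (convex hull {X, Y, Z})"
    using isom by (auto simp: scaled_copy_def)
  then show ?thesis
    unfolding hypotenuse_of_scaled_copy_def
    using ne by (intro exI[of _ Z])
      (auto simp: Z_def axis_parallel_def orthogonal_def inner_prod_def prod_eq_iff)
qed

section \<open>The nine-point circle of a right triangle\<close>

lemma nine_point_circle_right_triangle:
  fixes a b c :: real
  assumes "0 < a" "0 < b" "0 < c" "a\<^sup>2 + b\<^sup>2 = c\<^sup>2"
  shows "is_nine_point_circle (0, b) (a, 0) (0, 0) S \<longleftrightarrow> S = sphere (a / 4, b / 4) (c / 4)"
proof
  have mid: "midpoint (0, b) (a, 0) = (a / 2, b / 2)" "midpoint (a, 0) (0, 0) = (a / 2, 0)"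
    "midpoint (0, 0) (0, b) = (0, b / 2)"
    by (simp_all add: midpoint_def prod_eq_iff)
  have d: "dist (x, y) (u, v) = r \<longleftrightarrow> (x - u)\<^sup>2 + (y - v)\<^sup>2 = r\<^sup>2" if "0 < r" for x y u v r :: real
    using that by (auto simp: dist_prod_def dist_real_def real_sqrt_unique)
  {
    assume S: "S = sphere (a / 4, b / 4) (c / 4)"
    have c: "0 < c / 4"
      using assms by simp
    \<comment> \<open>Each of the three midpoints is offset from the center by \<open>a / 4\<close>
      horizontally and \<open>b / 4\<close> vertically, up to sign.\<close>
    have "(a / 4)\<^sup>2 + (b / 4)\<^sup>2 = (c / 4)\<^sup>2"
      using assms by (simp add: power_divide)
    then show "is_nine_point_circle (0, b) (a, 0) (0, 0) S"
      unfolding is_nine_point_circle_def mid S mem_sphere d[OF c]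
      using is_circle_sphere[OF c] by (simp add: power2_eq_square)
  }
  assume "is_nine_point_circle (0, b) (a, 0) (0, 0) S"
  then obtain x y r where S: "S = sphere (x, y) r" and r: "0 < r"
    and "dist (x, y) (a / 2, b / 2) = r" "dist (x, y) (a / 2, 0) = r" "dist (x, y) (0, b / 2) = r"
    unfolding is_nine_point_circle_def is_circle_def mid by auto
  then have eqs: "(x - a / 2)\<^sup>2 + (y - b / 2)\<^sup>2 = r\<^sup>2" "(x - a / 2)\<^sup>2 + y\<^sup>2 = r\<^sup>2"
    "x\<^sup>2 + (y - b / 2)\<^sup>2 = r\<^sup>2"
    by (auto simp: d)
  \<comment> \<open>Subtracting two circle equations cancels the quadratic terms and leaves one
    linear equation for each coordinate of the center.\<close>
  have "b * (y - b / 4) = ((x - a / 2)\<^sup>2 + y\<^sup>2) - ((x - a / 2)\<^sup>2 + (y - b / 2)\<^sup>2)"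
    by (simp add: power2_eq_square algebra_simps)
  moreover have "a * (x - a / 4) = (x\<^sup>2 + (y - b / 2)\<^sup>2) - ((x - a / 2)\<^sup>2 + (y - b / 2)\<^sup>2)"
    by (simp add: power2_eq_square algebra_simps)
  ultimately have "b * (y - b / 4) = 0" "a * (x - a / 4) = 0"
    unfolding eqs by simp_all
  then have xy: "x = a / 4" "y = b / 4"
    using assms by auto
  have "r\<^sup>2 = (c / 4)\<^sup>2"
    using eqs(2) assms(4) by (simp add: xy power_divide power2_eq_square algebra_simps)
  then have "r = c / 4"
    using r assms by simp
  then show "S = sphere (a / 4, b / 4) (c / 4)"
    by (simp only: S xy)
qed

theorem mainTheorem9:
  fixes a b c :: nat
    and A B C I1 I2 I3 I4 F :: point
    and r1 r2 r3 r4 :: real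
    and N :: "point set"
  assumes "primitive_triple (a, b, c)"
    and "C = (0, 0)" and "B = (real a, 0)" and "A = (0, real b)"
    and "r1 = 1/2 * (real a + real b - real c)"
    and "r2 = 1/2 * (real a - real b + real c)"
    and "r3 = 1/2 * (- real a + real b + real c)"
    and "r4 = 1/2 * (real a + real b + real c)"
    and "I1 = (r1, r1)" and "I2 = (r2, - r2)" and "I3 = (- r3, r3)" and "I4 = (r4, r4)"
    and "F = (real a / 4, real b / 4)"
    and "N = sphere F (real c / 4)"
  shows "is_incircle A B C (sphere I1 r1)
       \<and> is_excircle_opposite A B C (sphere I2 r2)
       \<and> is_excircle_opposite B C A (sphere I3 r3)
       \<and> is_excircle_opposite C A B (sphere I4 r4)
       \<and> (\<forall>S. is_nine_point_circle A B C S \<longleftrightarrow> S = N)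
       \<and> tangent_circles N (sphere I1 r1)
       \<and> tangent_circles N (sphere I2 r2)
       \<and> tangent_circles N (sphere I3 r3)
       \<and> tangent_circles N (sphere I4 r4)
       \<and> hypotenuse_of_scaled_copy (1/4) (left_child (a, b, c)) I3 F
       \<and> hypotenuse_of_scaled_copy (1/4) (middle_child (a, b, c)) I4 F
       \<and> hypotenuse_of_scaled_copy (1/4) (right_child (a, b, c)) I2 F
       \<and> ((a, b, c) \<noteq> (3, 4, 5) \<longrightarrow>
            hypotenuse_of_scaled_copy (1/4) (parent (a, b, c)) I1 F)"
proof -
  obtain s q where v: "valid_sequence (sequence_from s q)"
    and T: "(a, b, c) = triple_of (sequence_from s q)"
    using assms(1) by (blast elim: primitive_tripleE)
  \<comment> \<open>With \<open>x\<close> for \<open>q'\<close> and \<open>y\<close> for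
    \<open>q\<close>, the sides and radii become polynomials and the metric claims polynomial
    identities.\<close>
  define x y where "x = real s" and "y = real q"
  have xy: "0 < x" "0 < y"
    using v by (simp_all add: x_def y_def)
  have abc: "real a = x * (x + 2 * y)" "real b = 2 * y * (x + y)" "real c = (x + y)\<^sup>2 + y\<^sup>2"
    using T by (simp_all add: triple_of_sequence_from x_def y_def)
  have rs: "r1 = x * y" "r2 = x * (x + y)" "r3 = y * (x + 2 * y)" "r4 = (x + y) * (x + 2 * y)"
    unfolding assms(5-8) abc by (simp_all add: power2_eq_square algebra_simps)
  have rpos: "0 < r1" "0 < r2" "0 < r3" "0 < r4"
    using xy by (simp_all add: rs)
  have cpos: "0 < real c" "0 < real a" "0 < real b"
    using xy by (simp_all add: abc add_pos_pos)
  have pyth: "(real a)\<^sup>2 + (real b)\<^sup>2 = (real c)\<^sup>2"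
    unfolding abc by (simp add: power2_eq_square algebra_simps)
  have rel: "real a = r1 + r2" "real b = r1 + r3" "real c = r2 + r3" "r4 = r1 + r2 + r3"
    "r2 * r3 = r1 * r4"
    unfolding rs abc by (simp_all add: power2_eq_square algebra_simps)
  have dist_eq: "dist (t, u) (t', u') = d" if "(t - t')\<^sup>2 + (u - u')\<^sup>2 = d\<^sup>2" "0 \<le> d"
    for t u t' u' d :: real
    using that by (simp add: dist_prod_def dist_real_def)
  have dist2: "(dist (t, u) (t', u'))\<^sup>2 = (t - t')\<^sup>2 + (u - u')\<^sup>2" for t u t' u' :: real
    by (simp add: dist_prod_def dist_real_def)
  note pts = assms(2-4) assms(9-12)
  have AB: "dist A B = real c" "dist B A = real c"
    unfolding assms(2-4) using pyth cpos by (auto intro!: dist_eq simp: add.commute)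
  have BC: "dist B C = real a" "dist C B = real a"
    unfolding assms(2-4) using cpos by (auto intro!: dist_eq)
  have CA: "dist C A = real b" "dist A C = real b"
    unfolding assms(2-4) using cpos by (auto intro!: dist_eq)
  note geom = pts dist2[unfolded power2_eq_square] inner_prod_def rs abc power2_eq_square algebra_simps
  note pos = rpos rel cpos

  \<comment> \<open>The in-circle and the three ex-circles\<close>
  have in_circle: "is_incircle A B C (sphere I1 r1)"
    unfolding is_incircle_def
  proof (intro conjI)
    show "is_circle (sphere I1 r1)"
      using rpos by (simp add: is_circle_sphere)
    \<comment> \<open>\<open>r4\<close> is the semiperimeter, so the tangent lengths from
      \<open>A\<close>, \<open>B\<close>, \<open>C\<close> are \<open>r4 - a = r3\<close>,
      \<open>r4 - b = r2\<close>, \<open>r4 - c = r1\<close>.\<close>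
    show "touches_side (sphere I1 r1) A B"
      by (rule touches_sideI[OF _ AB(1), of _ r3]) (use pos in linarith | simp add: geom)+
    show "touches_side (sphere I1 r1) B C"
      by (rule touches_sideI[OF _ BC(1), of _ r2]) (use pos in linarith | simp add: geom)+
    show "touches_side (sphere I1 r1) C A"
      by (rule touches_sideI[OF _ CA(1), of _ r1]) (use pos in linarith | simp add: geom)+
  qed
  have ex_A: "is_excircle_opposite A B C (sphere I2 r2)"
    unfolding is_excircle_opposite_def
  proof (intro conjI)
    show "is_circle (sphere I2 r2)"
      using rpos by (simp add: is_circle_sphere)
    show "touches_side (sphere I2 r2) B C"
      by (rule touches_sideI[OF _ BC(1), of _ r1]) (use pos in linarith | simp add: geom)+
    \<comment> \<open>The tangent length from the vertex opposite an ex-circle is the semiperimeter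
      \<open>r4\<close>, which exceeds every side.\<close>
    show "touches_extension (sphere I2 r2) A B"
      by (rule touches_extensionI[OF _ _ AB(1), of _ r4]) (use pos in linarith | simp add: geom)+
    show "touches_extension (sphere I2 r2) A C"
      by (rule touches_extensionI[OF _ _ CA(2), of _ r4]) (use pos in linarith | simp add: geom)+
  qed
  have ex_B: "is_excircle_opposite B C A (sphere I3 r3)"
    unfolding is_excircle_opposite_def
  proof (intro conjI)
    show "is_circle (sphere I3 r3)"
      using rpos by (simp add: is_circle_sphere)
    show "touches_side (sphere I3 r3) C A"
      by (rule touches_sideI[OF _ CA(1), of _ r3]) (use pos in linarith | simp add: geom)+
    show "touches_extension (sphere I3 r3) B C"
      by (rule touches_extensionI[OF _ _ BC(1), of _ r4]) (use pos in linarith | simp add: geom)+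
    show "touches_extension (sphere I3 r3) B A"
      by (rule touches_extensionI[OF _ _ AB(2), of _ r4]) (use pos in linarith | simp add: geom)+
  qed
  have ex_C: "is_excircle_opposite C A B (sphere I4 r4)"
    unfolding is_excircle_opposite_def
  proof (intro conjI)
    show "is_circle (sphere I4 r4)"
      using rpos by (simp add: is_circle_sphere)
    show "touches_side (sphere I4 r4) A B"
      by (rule touches_sideI[OF _ AB(1), of _ r2]) (use pos in linarith | simp add: geom)+
    show "touches_extension (sphere I4 r4) C A"
      by (rule touches_extensionI[OF _ _ CA(1), of _ r4]) (use pos in linarith | simp add: geom)+
    show "touches_extension (sphere I4 r4) C B"
      by (rule touches_extensionI[OF _ _ BC(2), of _ r4]) (use pos in linarith | simp add: geom)+
  qed
  have nine: "\<forall>S. is_nine_point_circle A B C S \<longleftrightarrow> S = N"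
    using nine_point_circle_right_triangle[OF cpos(2,3,1) pyth] by (simp add: assms(2-4,13,14))

  \<comment> \<open>Tangency with the nine-point circle\<close>
  have "0 < (x - y)\<^sup>2 + y\<^sup>2"
    using xy by (simp add: sum_power2_gt_zero_iff)
  \<comment> \<open>The positive sum \<open>(x - y)\<^sup>2 + y\<^sup>2\<close> equals
    \<open>c - 4 * r1\<close>; thus the in-circle is the smaller circle and the tangency is
    internal.\<close>
  then have small: "r1 < real c / 4"
    unfolding rs abc by (simp add: power2_eq_square algebra_simps)
  have tan1: "tangent_circles N (sphere I1 r1)"
    unfolding assms(14)
    by (rule tangent_circles_internal[OF rpos(1) small], unfold assms(9,13), rule dist_eq)
      (use small in \<open>simp_all add: rs abc power2_eq_square field_simps\<close>)
  have tan2: "tangent_circles N (sphere I2 r2)"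
    unfolding assms(14)
    by (rule tangent_circles_external, use pos in simp, use pos in simp, unfold assms(10,13), rule dist_eq)
      (use pos in \<open>simp_all add: rs abc power2_eq_square field_simps\<close>)
  have tan3: "tangent_circles N (sphere I3 r3)"
    unfolding assms(14)
    by (rule tangent_circles_external, use pos in simp, use pos in simp, unfold assms(11,13), rule dist_eq)
      (use pos in \<open>simp_all add: rs abc power2_eq_square field_simps\<close>)
  have tan4: "tangent_circles N (sphere I4 r4)"
    unfolding assms(14)
    by (rule tangent_circles_external, use pos in simp, use pos in simp, unfold assms(12,13), rule dist_eq)
      (use pos in \<open>simp_all add: rs abc power2_eq_square field_simps\<close>)

  \<comment> \<open>Children and parent as scaled right triangles\<close>
  have spos: "0 < s" "0 < q"
    using v by simp_all
  \<comment> \<open>Coordinate differences between a center and \<open>F\<close> may have either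
    sign; this reduces each leg length to a polynomial identity up to sign.\<close>
  have abs_eq: "\<bar>t\<bar> = u" if "t = u \<or> t = - u" "0 \<le> u" for t u :: real
    using that by auto
  have left: "hypotenuse_of_scaled_copy (1/4) (left_child (a, b, c)) I3 F"
    unfolding T left_child_triple_of[OF v]
    unfolding triple_of_sequence_from
    by (rule hypotenuse_of_scaled_copyI; (rule abs_eq)?)
      (use spos in \<open>simp_all add: assms(11,13) rs abc x_def y_def field_simps\<close>)
  have middle: "hypotenuse_of_scaled_copy (1/4) (middle_child (a, b, c)) I4 F"
    unfolding T middle_child_triple_of[OF v]
    unfolding triple_of_sequence_from
    by (rule hypotenuse_of_scaled_copyI; (rule abs_eq)?)
      (use spos in \<open>simp_all add: assms(12,13) rs abc x_def y_def field_simps\<close>)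
  have right: "hypotenuse_of_scaled_copy (1/4) (right_child (a, b, c)) I2 F"
    unfolding T right_child_triple_of[OF v]
    unfolding triple_of_sequence_from
    by (rule hypotenuse_of_scaled_copyI; (rule abs_eq)?)
      (use spos in \<open>simp_all add: assms(10,13) rs abc x_def y_def field_simps\<close>)
  have par: "hypotenuse_of_scaled_copy (1/4) (parent (a, b, c)) I1 F" if "(a, b, c) \<noteq> (3, 4, 5)"
  proof -
    have "(s, q) \<noteq> (1, 1)"
      using that unfolding T by (auto simp: triple_of_sequence_from power2_eq_square)
    then obtain s' q' where v': "valid_sequence (sequence_from s' q')" and child:
      "(s = s' + 2 * q' \<and> q = q') \<or> (s = s' + 2 * q' \<and> q = s' + q') \<or> (s = s' \<and> q = s' + q')"
      using parent_sequence_exists[OF v] by blast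
    have pos': "0 < s'" "0 < q'"
      using v' by simp_all
    \<comment> \<open>Four times the offsets of \<open>I1\<close> from \<open>F\<close> are
      \<open>x * (2 * y - x)\<close> and \<open>2 * y * (x - y)\<close>. Their signs depend on how
      \<open>x\<close> compares with \<open>2 * y\<close> and \<open>y\<close>, which is what the
      three cases of \<open>child\<close> decide.\<close>
    show ?thesis
      unfolding T parent_triple_of[OF v v' child]
      unfolding triple_of_sequence_from
      by (rule hypotenuse_of_scaled_copyI; (rule abs_eq)?)
        (use pos' child in \<open>auto simp: assms(9,13) rs abc x_def y_def field_simps\<close>)
  qed
  show ?thesis
    using in_circle ex_A ex_B ex_C nine tan1 tan2 tan3 tan4 left middle right par by blast
qed

end
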